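(* Let $k$ and $n$ be positive integers with $n\neq2$, and for $1\le i\le k$ put $y_i=(-1)^i\sum_{j=1}^{i}\frac{B_j^+\,s(i,j)}{j}J_j(n\alpha_n)$. Then \[\frac{\Phi_n^{(k)}(-1)}{\Phi_n(-1)}=\mathcal{B}_k(y_1,\dots,y_k).\]
   Context: $\Phi_n$ is the $n$-th cyclotomic polynomial. $\alpha_n=2$ if $n$ is odd, $\alpha_n=1/2$ if $2\mid n$, $4\nmid n$, and $\alpha_n=1$ if $4\mid n$. $s(i,j)$: signed Stirling numbers of the first kind ($x(x-1)\cdots(x-i+1)=\sum_j s(i,j)x^j$); $B_j^+$: $\frac{te^t}{e^t-1}=\sum_j B_j^+t^j/j!$; $J_j(m)=m^j\prod_{p\mid m}(1-p^{-j})$. The complete Bell polynomial is $\mathcal{B}_k(x_1,\dots,x_k)=\sum\frac{k!}{\lambda_1!\cdots\lambda_k!}\prod_{j=1}^k(x_j/j!)^{\lambda_j}$ over non-negative integer tuples with $\sum_j j\lambda_j=k$. *)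

theory Defs
  imports
    "HOL-Analysis.Analysis"
    "HOL-Computational_Algebra.Computational_Algebra"
begin

definition cyclotomic_poly :: "nat \<Rightarrow> complex poly" where
  "cyclotomic_poly n =
     (\<Prod>a\<in>{a\<in>{1..n}. coprime a n}. [:- cis (2 * pi * real a / real n), 1:])"

definition alpha :: "nat \<Rightarrow> real" where
  "alpha n = (if odd n then 2 else if \<not> 4 dvd n then 1 / 2 else 1)"

text \<open>The product of \<^term>\<open>n\<close> and \<^term>\<open>alpha n\<close> is always a natural number, so the floor
  below only changes the type, as the lemma shows.\<close>

definition n_alpha :: "nat \<Rightarrow> nat" where
  "n_alpha n = nat \<lfloor>real n * alpha n\<rfloor>"

lemma of_nat_n_alpha: "real (n_alpha n) = real n * alpha n"
proof -
  have "real n * alpha n \<in> \<nat>"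
  proof (cases "even n")
    case True
    then obtain m where "n = 2 * m" by blast
    then show ?thesis by (auto simp: alpha_def)
  next
    case False
    then have "real n * alpha n = real (n * 2)" by (simp add: alpha_def)
    then show ?thesis by (metis of_nat_in_Nats)
  qed
  then show ?thesis by (auto simp: n_alpha_def elim!: Nats_cases)
qed

definition signed_stirling :: "nat \<Rightarrow> nat \<Rightarrow> int" where
  "signed_stirling i j = coeff (\<Prod>l<i. [:- int l, 1:]) j"

text \<open>The Bernoulli numbers with the convention \<open>B\<^sub>1 = 1/2\<close>. Both series in the quotient have
  subdegree 1, so it is an exact division of formal power series.\<close>

definition bernoulli_plus_fps :: "real fps" where
  "bernoulli_plus_fps = (fps_X * fps_exp 1) / (fps_exp 1 - 1)"

definition bernoulli_plus :: "nat \<Rightarrow> real" where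
  "bernoulli_plus j = fact j * fps_nth bernoulli_plus_fps j"

lemma bernoulli_plus_fps_mult:
  "bernoulli_plus_fps * (fps_exp 1 - 1) = fps_X * fps_exp 1"
proof -
  have ne: "fps_exp (1::real) - 1 \<noteq> 0"
  proof
    assume "fps_exp (1::real) - 1 = 0"
    then have "fps_nth (fps_exp (1::real) - 1) 1 = 0" by simp
    then show False by simp
  qed
  have sd: "subdegree (fps_exp (1::real) - 1) = 1"
    by (rule subdegreeI) auto
  have "subdegree (fps_X * fps_exp (1::real)) = 1"
    by (rule subdegreeI) auto
  then have "fps_exp (1::real) - 1 dvd fps_X * fps_exp 1"
    using ne sd by (subst fps_dvd_iff) auto
  then show ?thesis unfolding bernoulli_plus_fps_def by (rule dvd_div_mult_self)
qed

definition jordan_totient :: "nat \<Rightarrow> nat \<Rightarrow> real" where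
  "jordan_totient j m = real m ^ j * (\<Prod>p\<in>{p. prime p \<and> p dvd m}. 1 - 1 / real p ^ j)"

text \<open>A tuple \<open>(\<lambda>\<^sub>1, \<dots>, \<lambda>\<^sub>k)\<close> is a function on the naturals that vanishes outside
  \<open>{1..k}\<close>.\<close>

definition bell_tuples :: "nat \<Rightarrow> (nat \<Rightarrow> nat) set" where
  "bell_tuples k = {r. (\<forall>j. j \<notin> {1..k} \<longrightarrow> r j = 0) \<and> (\<Sum>j=1..k. j * r j) = k}"

lemma finite_bell_tuples: "finite (bell_tuples k)"
proof (rule finite_subset)
  show "bell_tuples k \<subseteq>
          {r. \<forall>j. (j \<in> {1..k} \<longrightarrow> r j \<in> {0..k}) \<and> (j \<notin> {1..k} \<longrightarrow> r j = 0)}"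
  proof
    fix r assume r: "r \<in> bell_tuples k"
    have "r j \<in> {0..k}" if "j \<in> {1..k}" for j
    proof -
      have "r j \<le> j * r j" using that by simp
      also have "\<dots> \<le> (\<Sum>j=1..k. j * r j)" using that by (intro member_le_sum) auto
      finally show ?thesis using r by (simp add: bell_tuples_def)
    qed
    then show "r \<in> {r. \<forall>j. (j \<in> {1..k} \<longrightarrow> r j \<in> {0..k}) \<and> (j \<notin> {1..k} \<longrightarrow> r j = 0)}"
      using r by (simp add: bell_tuples_def)
  qed
  show "finite {r. \<forall>j. (j \<in> {1..k} \<longrightarrow> r j \<in> {0..k}) \<and> (j \<notin> {1..k} \<longrightarrow> r j = (0::nat))}"
    by (rule finite_set_of_finite_funs) auto
qed

definition complete_bell :: "nat \<Rightarrow> (nat \<Rightarrow> real) \<Rightarrow> real" where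
  "complete_bell k x =
     (\<Sum>r\<in>bell_tuples k. fact k / (\<Prod>j=1..k. fact (r j)) * (\<Prod>j=1..k. (x j / fact j) ^ r j))"

end

theory Submission
  imports Defs
begin

text \<open>
  Put \<open>N = n \<alpha>\<^sub>n\<close>. The primitive \<open>N\<close>-th roots of unity are the negatives of the primitive \<open>n\<close>-th
  ones, so the expansion of \<open>\<Phi>\<^sub>n\<close> at \<open>-1\<close> is, up to sign, that of \<open>\<Phi>\<^sub>N\<close> at \<open>1\<close> with \<open>u\<close> replaced by
  \<open>-u\<close>, and \<open>N > 1\<close> because \<open>n \<noteq> 2\<close>. Let \<open>P\<^sub>d(u) = \<Phi>\<^sub>d(1 + u)\<close> and \<open>t = ln (1 + u)\<close>. The product of the
  \<open>P\<^sub>d\<close> over the divisors \<open>d \<noteq> 1\<close> of \<open>N\<close> is \<open>(e\<^bsup>Nt\<^esup> - 1) / (e\<^bsup>t\<^esup> - 1)\<close>, whose logarithmic derivative in \<open>t\<close>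
  has the coefficients \<open>B\<^sub>j\<^sup>+ (N\<^sup>j - 1) / j!\<close> at \<open>t\<^bsup>j-1\<^esup>\<close>. Since \<open>N\<^sup>j\<close> is the sum of \<open>J\<^sub>j(d)\<close> over the divisors
  \<open>d\<close> of \<open>N\<close>, induction over \<open>N\<close> shows that the logarithmic derivative of \<open>P\<^sub>N\<close> in \<open>t\<close> has the
  coefficients \<open>B\<^sub>j\<^sup>+ J\<^sub>j(N) / j!\<close>. Integrating and expanding the powers of \<open>t\<close> in \<open>u\<close> brings in the
  Stirling numbers, and exponentiating yields the complete Bell polynomial.
\<close>

unbundle no vec_syntax

subsection \<open>Complete Bell polynomials\<close>

text \<open>An index above \<open>N\<close> with a nonzero entry would alone contribute more than
  \<open>N\<close> to the sum. This lets tuples of different total weight share one index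
  range.\<close>

lemma bell_tuples_extend:
  assumes "N \<le> K"
  shows "bell_tuples N = {r. (\<forall>j. j \<notin> {1..K} \<longrightarrow> r j = 0) \<and> (\<Sum>j=1..K. j * r j) = N}"
proof (intro set_eqI iffI)
  fix r assume r: "r \<in> bell_tuples N"
  have "(\<Sum>j=1..K. j * r j) = (\<Sum>j=1..N. j * r j)"
    using r assms by (intro sum.mono_neutral_right) (auto simp: bell_tuples_def)
  then show "r \<in> {r. (\<forall>j. j \<notin> {1..K} \<longrightarrow> r j = 0) \<and> (\<Sum>j=1..K. j * r j) = N}"
    using r assms by (auto simp: bell_tuples_def)
next
  fix r assume r: "r \<in> {r. (\<forall>j. j \<notin> {1..K} \<longrightarrow> r j = 0) \<and> (\<Sum>j=1..K. j * r j) = N}"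
  have z: "r j = 0" if "j \<notin> {1..N}" for j
  proof (cases "j \<in> {1..K}")
    case True
    then have "j * r j \<le> (\<Sum>j=1..K. j * r j)" by (intro member_le_sum) auto
    then have "j * r j \<le> N" using r by simp
    moreover have "N < j" using that True by auto
    ultimately show ?thesis by (cases "r j") auto
  qed (use r in auto)
  have "(\<Sum>j=1..N. j * r j) = (\<Sum>j=1..K. j * r j)"
    using z assms by (intro sum.mono_neutral_left) auto
  then show "r \<in> bell_tuples N" using r z by (simp add: bell_tuples_def)
qed

text \<open>One summand of the Bell polynomial without the factorial of the total weight. The range
  \<open>K\<close> is kept separate from that weight, so the same formula still applies after a part
  is removed.\<close>

definition bell_weight :: "nat \<Rightarrow> (nat \<Rightarrow> real) \<Rightarrow> (nat \<Rightarrow> nat) \<Rightarrow> real" where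
  "bell_weight K x r = (\<Prod>j=1..K. (x j / fact j) ^ r j / fact (r j))"

lemma complete_bell_eq_weight:
  assumes "N \<le> K"
  shows "complete_bell N x / fact N = (\<Sum>r\<in>bell_tuples N. bell_weight K x r)"
proof -
  have "complete_bell N x / fact N = (\<Sum>r\<in>bell_tuples N. bell_weight N x r)"
    by (simp add: complete_bell_def bell_weight_def sum_divide_distrib prod_dividef)
  also have "\<dots> = (\<Sum>r\<in>bell_tuples N. bell_weight K x r)"
    unfolding bell_weight_def using assms
    by (intro sum.cong prod.mono_neutral_left) (auto simp: bell_tuples_def)
  finally show ?thesis .
qed

lemma bell_weight_step:
  assumes "j \<in> {1..K}"
  shows "real (Suc (r j)) * bell_weight K x (r(j := Suc (r j))) = x j / fact j * bell_weight K x r"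
proof -
  have "bell_weight K x (r(j := Suc (r j))) = (x j / fact j) ^ Suc (r j) / fact (Suc (r j)) *
      (\<Prod>i\<in>{1..K} - {j}. (x i / fact i) ^ r i / fact (r i))"
    unfolding bell_weight_def using assms by (subst prod.remove[of _ j]) auto
  moreover have "bell_weight K x r = (x j / fact j) ^ r j / fact (r j) *
      (\<Prod>i\<in>{1..K} - {j}. (x i / fact i) ^ r i / fact (r i))"
    unfolding bell_weight_def using assms by (subst prod.remove[of _ j]) auto
  ultimately show ?thesis by simp
qed

text \<open>For \<open>g = exp h\<close> this is \<open>g' = h' g\<close> read off coefficientwise.
  Combinatorially, \<open>N\<close> is written as the sum of \<open>j * r j\<close> in each term,
  and one part of size \<open>j\<close> is then removed from each tuple that has one.\<close>

lemma complete_bell_recurrence: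
  assumes "N > 0"
  shows "real N * (complete_bell N x / fact N) =
    (\<Sum>j=1..N. x j / fact (j - 1) * (complete_bell (N - j) x / fact (N - j)))"
proof -
  let ?W = "bell_weight N x"
  have fin: "finite (bell_tuples M)" for M by (rule finite_bell_tuples)
  have "real N * (complete_bell N x / fact N) = (\<Sum>r\<in>bell_tuples N. real N * ?W r)"
    by (subst complete_bell_eq_weight[of N N]) (simp_all add: sum_distrib_left)
  also have "\<dots> = (\<Sum>r\<in>bell_tuples N. (\<Sum>j=1..N. real j * (real (r j) * ?W r)))"
  proof (rule sum.cong[OF refl])
    fix r assume "r \<in> bell_tuples N"
    then have "(\<Sum>j=1..N. j * r j) = N" by (simp add: bell_tuples_def)
    then have "real N = (\<Sum>j=1..N. real j * real (r j))"
      by (simp flip: of_nat_mult of_nat_sum)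
    then show "real N * ?W r = (\<Sum>j=1..N. real j * (real (r j) * ?W r))"
      by (simp add: sum_distrib_right mult.assoc)
  qed
  also have "\<dots> = (\<Sum>j=1..N. real j * (\<Sum>r\<in>bell_tuples N. real (r j) * ?W r))"
    by (subst sum.swap) (simp add: sum_distrib_left)
  also have "\<dots> = (\<Sum>j=1..N. real j * (x j / fact j * (complete_bell (N - j) x / fact (N - j))))"
  proof (rule sum.cong[OF refl], rule arg_cong[where f = "(*) _"])
    fix j assume j: "j \<in> {1..N}"
    have "(\<Sum>r\<in>bell_tuples N. real (r j) * ?W r) = (\<Sum>r\<in>{r\<in>bell_tuples N. r j > 0}. real (r j) * ?W r)"
      using fin by (intro sum.mono_neutral_right) auto
    also have "\<dots> = (\<Sum>r\<in>bell_tuples (N - j). x j / fact j * ?W r)"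
    proof (rule sum.reindex_bij_witness[where i = "\<lambda>r. r(j := Suc (r j))" and j = "\<lambda>r. r(j := r j - 1)"])
      fix r assume r: "r \<in> {r\<in>bell_tuples N. r j > 0}"
      have "(\<Sum>i=1..N. i * r i) = j * r j + (\<Sum>i\<in>{1..N}-{j}. i * r i)"
        using j by (intro sum.remove) auto
      moreover have "(\<Sum>i=1..N. i * (r(j := r j - 1)) i) = j * (r j - 1) + (\<Sum>i\<in>{1..N}-{j}. i * r i)"
        using j by (subst sum.remove[of _ j]) auto
      moreover have "j * r j = j * (r j - 1) + j" using r by (cases "r j") auto
      ultimately show "r(j := r j - 1) \<in> bell_tuples (N - j)"
        using r j by (subst bell_tuples_extend[of _ N]) (auto simp: bell_tuples_def)
      have "(r(j := r j - 1))(j := Suc ((r(j := r j - 1)) j)) = r" using r by auto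
      then show "(r(j := r j - 1))(j := Suc ((r(j := r j - 1)) j)) = r" .
      then show "x j / fact j * ?W (r(j := r j - 1)) = real (r j) * ?W r"
        using bell_weight_step[OF j, of "r(j := r j - 1)" x] r by simp
    next
      fix r assume r: "r \<in> bell_tuples (N - j)"
      then have r': "(\<forall>i. i \<notin> {1..N} \<longrightarrow> r i = 0)" "(\<Sum>i=1..N. i * r i) = N - j"
        by (subst (asm) bell_tuples_extend[of _ N]; simp)+
      have "(\<Sum>i=1..N. i * r i) = j * r j + (\<Sum>i\<in>{1..N}-{j}. i * r i)"
        using j by (intro sum.remove) auto
      moreover have "(\<Sum>i=1..N. i * (r(j := Suc (r j))) i) = j * Suc (r j) + (\<Sum>i\<in>{1..N}-{j}. i * r i)"
        using j by (subst sum.remove[of _ j]) auto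
      ultimately show "r(j := Suc (r j)) \<in> {r\<in>bell_tuples N. r j > 0}"
        using r' j by (auto simp: bell_tuples_def)
    qed auto
    also have "\<dots> = x j / fact j * (complete_bell (N - j) x / fact (N - j))"
      by (subst complete_bell_eq_weight[of _ N]) (simp_all add: sum_distrib_left)
    finally show "(\<Sum>r\<in>bell_tuples N. real (r j) * ?W r) = x j / fact j * (complete_bell (N - j) x / fact (N - j))" .
  qed
  also have "\<dots> = (\<Sum>j=1..N. x j / fact (j - 1) * (complete_bell (N - j) x / fact (N - j)))"
  proof (rule sum.cong[OF refl])
    fix j assume "j \<in> {1..N}"
    then have "fact j = real j * fact (j - 1)" by (simp add: fact_reduce)
    then show "real j * (x j / fact j * (complete_bell (N - j) x / fact (N - j))) =
        x j / fact (j - 1) * (complete_bell (N - j) x / fact (N - j))"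
      using \<open>j \<in> {1..N}\<close> by simp
  qed
  finally show ?thesis .
qed

lemma complete_bell_0 [simp]: "complete_bell 0 x = 1"
proof -
  have "bell_tuples 0 = {\<lambda>_. 0}" by (auto simp: bell_tuples_def)
  then show ?thesis by (simp add: complete_bell_def)
qed

text \<open>On coefficients the differential equation is the Bell recurrence, so strong induction
  determines each coefficient up to \<open>k\<close> from \<open>g $ 0\<close>.\<close>

lemma fps_nth_eq_complete_bell:
  fixes g F :: "complex fps"
  assumes ode: "fps_deriv g = F * g"
    and F: "\<And>i. i < k \<Longrightarrow> F $ i = of_real (x (Suc i)) / fact i"
  shows "fact k * g $ k = g $ 0 * of_real (complete_bell k x)"
proof -
  have "m \<le> k \<Longrightarrow> g $ m = g $ 0 * of_real (complete_bell m x / fact m)" for m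
  proof (induction m rule: less_induct)
    case (less m)
    show ?case
    proof (cases m)
      case (Suc N)
      have "of_nat m * g $ m = fps_deriv g $ N" by (simp add: Suc)
      also have "\<dots> = (\<Sum>i=0..N. F $ i * g $ (N - i))" by (simp add: ode fps_mult_nth)
      also have "\<dots> = (\<Sum>i=0..N. g $ 0 * of_real (x (Suc i) / fact i * (complete_bell (N - i) x / fact (N - i))))"
      proof (rule sum.cong[OF refl])
        fix i assume i: "i \<in> {0..N}"
        have "g $ (N - i) = g $ 0 * of_real (complete_bell (N - i) x / fact (N - i))"
          using less.prems Suc by (intro less.IH) auto
        moreover have "F $ i = of_real (x (Suc i)) / fact i"
          using less.prems Suc i by (intro F) auto
        ultimately show "F $ i * g $ (N - i) =
            g $ 0 * of_real (x (Suc i) / fact i * (complete_bell (N - i) x / fact (N - i)))"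
          by simp
      qed
      also have "\<dots> = g $ 0 * of_real (\<Sum>i=0..N. x (Suc i) / fact i * (complete_bell (N - i) x / fact (N - i)))"
        by (simp add: sum_distrib_left)
      also have "(\<Sum>i=0..N. x (Suc i) / fact i * (complete_bell (N - i) x / fact (N - i))) =
          (\<Sum>j=1..m. x j / fact (j - 1) * (complete_bell (m - j) x / fact (m - j)))"
        unfolding Suc by (rule sum.reindex_bij_witness[of _ "\<lambda>j. j - 1" Suc]) auto
      also have "\<dots> = real m * (complete_bell m x / fact m)"
        using Suc by (subst complete_bell_recurrence) auto
      finally have "of_nat m * g $ m = of_nat m * (g $ 0 * of_real (complete_bell m x / fact m))"
        by (simp add: ac_simps)
      moreover have "(of_nat m :: complex) \<noteq> 0" using Suc by (simp del: of_nat_Suc)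
      ultimately show ?thesis by (metis mult_left_cancel)
    qed simp
  qed
  from this[of k] show ?thesis by simp
qed

subsection \<open>Jordan totients\<close>

lemma jordan_totient_1: "jordan_totient j 1 = 1"
proof -
  have no_prime: "{p::nat. p = Suc 0 \<and> prime p} = {}" by auto
  show ?thesis by (simp add: jordan_totient_def no_prime)
qed

lemma jordan_totient_prime_power_mult:
  assumes "prime p" "\<not> p dvd m" "m > 0" "a > 0"
  shows "jordan_totient j (p ^ a * m) = real p ^ (a * j) * (1 - 1 / real p ^ j) * jordan_totient j m"
proof -
  have "{q. prime q \<and> q dvd p ^ a * m} = insert p {q. prime q \<and> q dvd m}"
    using assms by (auto simp: prime_dvd_mult_iff prime_dvd_power_iff primes_dvd_imp_eq)
  moreover have "finite {q. prime q \<and> q dvd m}"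
    by (rule finite_subset[of _ "{..m}"]) (use assms in \<open>auto intro: dvd_imp_le\<close>)
  ultimately show ?thesis
    using assms by (simp add: jordan_totient_def power_mult_distrib power_mult)
qed

text \<open>Write \<open>n = p ^ Suc a * m\<close> with \<open>p\<close> prime and not dividing
  \<open>m\<close>. A divisor of \<open>n\<close> either divides \<open>p ^ a * m\<close> or is
  \<open>p ^ Suc a * e\<close> with \<open>e dvd m\<close>. By induction the first kind sums to
  \<open>(p ^ a * m) ^ j\<close>, and the second kind to the difference between that and
  \<open>n ^ j\<close>.\<close>

lemma sum_jordan_totient_divisors:
  assumes "n > 0"
  shows "(\<Sum>d | d dvd n. jordan_totient j d) = real n ^ j"
  using assms
proof (induction n rule: less_induct)
  case (less n)
  show ?case
  proof (cases "n = 1")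
    case True
    then show ?thesis using jordan_totient_1 by simp
  next
    case False
    then obtain p where p: "prime p" "p dvd n" using prime_factor_nat by blast
    obtain a' m where n: "n = p ^ a' * m" and m: "\<not> p dvd m"
      using multiplicity_decompose'[of n p] p less.prems by (metis not_prime_unit neq0_conv)
    have "a' \<noteq> 0" using n m p by (auto intro!: gr0I)
    then obtain a where a': "a' = Suc a" by (cases a') auto
    have m0: "m > 0" using n less.prems by (auto intro!: gr0I)
    have p1: "p > 1" using p prime_gt_1_nat by blast
    have div: "{d. d dvd n} = {d. d dvd p ^ a * m} \<union> (\<lambda>e. p ^ Suc a * e) ` {e. e dvd m}"
    proof (intro set_eqI iffI)
      fix d assume "d \<in> {d. d dvd n}"
      then have "d dvd p ^ Suc a * m" by (simp add: n a')
      then obtain b c where bc: "d = b * c" "b dvd p ^ Suc a" "c dvd m" using division_decomp by blast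
      then obtain i where i: "b = p ^ i" "i \<le> Suc a" using divides_primepow_nat[OF p(1)] by blast
      show "d \<in> {d. d dvd p ^ a * m} \<union> (\<lambda>e. p ^ Suc a * e) ` {e. e dvd m}"
      proof (cases "i = Suc a")
        case False
        then have "b dvd p ^ a" using i by (simp add: le_imp_power_dvd)
        then show ?thesis using bc by (simp add: mult_dvd_mono)
      qed (use bc i in auto)
    next
      fix d assume "d \<in> {d. d dvd p ^ a * m} \<union> (\<lambda>e. p ^ Suc a * e) ` {e. e dvd m}"
      then show "d \<in> {d. d dvd n}"
        by (auto simp: n a' mult_dvd_mono mult.assoc[of p] intro: dvd_mult)
    qed
    have disj: "{d. d dvd p ^ a * m} \<inter> (\<lambda>e. p ^ Suc a * e) ` {e. e dvd m} = {}"
    proof -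
      have False if "p ^ Suc a * e dvd p ^ a * m" for e
      proof -
        have "p ^ a * (p * e) dvd p ^ a * m" using that by (simp add: mult_ac)
        then have "p * e dvd m" using p1 by simp
        then show False using m by (auto dest: dvd_mult_left)
      qed
      then show ?thesis by blast
    qed
    have "(\<Sum>d | d dvd n. jordan_totient j d) =
        (\<Sum>d | d dvd p ^ a * m. jordan_totient j d) + (\<Sum>e | e dvd m. jordan_totient j (p ^ Suc a * e))"
      unfolding div using m0 p1 disj
      by (subst sum.union_disjoint) (auto simp: sum.reindex inj_on_def)
    also have "(\<Sum>d | d dvd p ^ a * m. jordan_totient j d) = real (p ^ a * m) ^ j"
      using p1 m0 by (intro less.IH) (auto simp: n a')
    also have "(\<Sum>e | e dvd m. jordan_totient j (p ^ Suc a * e)) =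
        (\<Sum>e | e dvd m. real p ^ (Suc a * j) * (1 - 1 / real p ^ j) * jordan_totient j e)"
      using p m m0 by (intro sum.cong jordan_totient_prime_power_mult) (auto dest: dvd_trans intro!: gr0I)
    also have "\<dots> = real p ^ (Suc a * j) * (1 - 1 / real p ^ j) * real m ^ j"
    proof -
      have "1 < p ^ a'" using p1 \<open>a' \<noteq> 0\<close> by (intro one_less_power) auto
      then have "m < n" using m0 by (simp add: n)
      then show ?thesis using less.IH[of m] m0 by (simp flip: sum_distrib_left)
    qed
    also have "real (p ^ a * m) ^ j + \<dots> = real n ^ j"
      using p1 by (simp add: n a' power_mult_distrib power_add algebra_simps flip: power_mult)
    finally show ?thesis .
  qed
qed

subsection \<open>Primitive roots of unity\<close>

text \<open>Order exactly \<open>n\<close>, stated for all exponents at once, so that equations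
  between powers turn into divisibilities.\<close>

definition prim_roots :: "nat \<Rightarrow> complex set" where
  "prim_roots n = {z. \<forall>m. z ^ m = 1 \<longleftrightarrow> n dvd m}"

lemma prim_rootsD: "z \<in> prim_roots n \<Longrightarrow> z ^ m = 1 \<longleftrightarrow> n dvd m"
  unfolding prim_roots_def by blast

lemma prim_roots_power: "z \<in> prim_roots n \<Longrightarrow> z ^ n = 1"
  using prim_rootsD[of z n n] by simp

lemma finite_prim_roots:
  assumes "n > 0"
  shows "finite (prim_roots n)"
proof (rule finite_subset)
  show "prim_roots n \<subseteq> {z. z ^ n = 1}" by (auto intro: prim_roots_power)
  show "finite {z::complex. z ^ n = 1}" using assms by (intro finite_roots_unity) simp
qed

text \<open>Each root has an order \<open>d\<close>, its least positive exponent giving 1; division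
  with remainder shows that the exponents giving 1 are the multiples of \<open>d\<close>.\<close>

lemma roots_unity_eq_Union_prim_roots:
  assumes "n > 0"
  shows "{z::complex. z ^ n = 1} = (\<Union>d\<in>{d. d dvd n}. prim_roots d)"
proof (intro set_eqI iffI)
  fix z :: complex assume "z \<in> {z. z ^ n = 1}"
  then have zn: "z ^ n = 1" by simp
  define d where "d = (LEAST m. m > 0 \<and> z ^ m = 1)"
  have d: "d > 0 \<and> z ^ d = 1" unfolding d_def by (rule LeastI[of _ n]) (use assms zn in auto)
  have min: "m = 0" if "m < d" "z ^ m = 1" for m
    using not_less_Least[of m "\<lambda>m. m > 0 \<and> z ^ m = 1"] that by (auto simp: d_def)
  have "z ^ m = 1 \<longleftrightarrow> d dvd m" for m
  proof
    assume "z ^ m = 1"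
    moreover have "z ^ m = (z ^ d) ^ (m div d) * z ^ (m mod d)"
      by (metis power_mult power_add mult_div_mod_eq)
    ultimately have "z ^ (m mod d) = 1" using d by simp
    then have "m mod d = 0" using d by (intro min) auto
    then show "d dvd m" by auto
  next
    assume "d dvd m"
    then obtain q where "m = d * q" by blast
    then show "z ^ m = 1" using d by (simp add: power_mult)
  qed
  then have "z \<in> prim_roots d" "d dvd n" using zn unfolding prim_roots_def by blast+
  then show "z \<in> (\<Union>d\<in>{d. d dvd n}. prim_roots d)" by blast
next
  fix z assume "z \<in> (\<Union>d\<in>{d. d dvd n}. prim_roots d)"
  then obtain d where "d dvd n" "z \<in> prim_roots d" by blast
  then show "z \<in> {z. z ^ n = 1}" using prim_rootsD[of z d n] by simp
qed

lemma prim_roots_disjoint: "d \<noteq> e \<Longrightarrow> prim_roots d \<inter> prim_roots e = {}"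
proof (rule ccontr)
  assume "d \<noteq> e" "prim_roots d \<inter> prim_roots e \<noteq> {}"
  then obtain z where "z \<in> prim_roots d" "z \<in> prim_roots e" by blast
  then have "d dvd m \<longleftrightarrow> e dvd m" for m by (simp add: prim_roots_def)
  then show False using \<open>d \<noteq> e\<close> by (metis dvd_antisym dvd_refl)
qed

lemma prim_roots_eq_image_cis:
  assumes "n > 0"
  shows "prim_roots n = (\<lambda>a. cis (2 * pi * real a / real n)) ` {a\<in>{1..n}. coprime a n}"
proof -
  define f where "f = (\<lambda>a. cis (2 * pi * real a / real n))"
  have pow: "f a ^ m = f (a * m)" for a m
    by (simp add: f_def Complex.DeMoivre mult_ac)
  have one: "f a = 1 \<longleftrightarrow> n dvd a" for a
    using complex_root_unity_eq_1[of n a] assms by (simp add: f_def cis_conv_exp mult_ac)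
  have prim: "f a \<in> prim_roots n \<longleftrightarrow> coprime a n" for a
  proof
    assume "coprime a n"
    then have "n dvd a * m \<longleftrightarrow> n dvd m" for m
      by (subst coprime_dvd_mult_right_iff) (simp_all add: coprime_commute)
    then show "f a \<in> prim_roots n" by (simp add: prim_roots_def pow one)
  next
    assume p: "f a \<in> prim_roots n"
    \<comment> \<open>The exponent \<open>n div gcd a n\<close> already sends \<open>f a\<close> to
      1, so \<open>n\<close> divides it, which forces the gcd to be 1.\<close>
    define g where "g = gcd a n"
    obtain a' n' where g: "a = g * a'" "n = g * n'"
      using gcd_dvd1[of a n] gcd_dvd2[of a n] unfolding g_def dvd_def by blast
    then have "n' > 0" "g > 0" "n div g = n'" using assms by auto
    have "n dvd a * (n div g)" by (simp add: \<open>n div g = n'\<close>) (simp add: g)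
    then have "f a ^ (n div g) = 1" by (simp only: pow one)
    then have "n dvd n'" using prim_rootsD[OF p] \<open>n div g = n'\<close> by simp
    then have "g * n' \<le> n'" using dvd_imp_le[OF _ \<open>n' > 0\<close>] g(2) by metis
    then have "g = 1" using \<open>n' > 0\<close> \<open>g > 0\<close> by simp
    then show "coprime a n" by (simp add: g_def coprime_iff_gcd_eq_1)
  qed
  have "z \<in> f ` {1..n}" if "z \<in> prim_roots n" for z
  proof -
    have "z ^ n = 1" by (rule prim_roots_power[OF that])
    then have "z \<in> f ` {..<n}"
      using Complex.bij_betw_roots_unity[OF assms] unfolding bij_betw_def f_def by blast
    then obtain a where "a < n" "z = f a" by auto
    then show ?thesis
    proof (cases "a = 0")
      case True
      \<comment> \<open>The roots of unity are enumerated from 0 to \<open>n - 1\<close>, the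
        factors of \<open>cyclotomic_poly\<close> from 1 to \<open>n\<close>, so index 0 is traded
        for \<open>n\<close>.\<close>
      have "f n = f 0" using one[of n] one[of 0] by simp
      then have "z = f n" using \<open>z = f a\<close> True by simp
      then show ?thesis using assms by auto
    next
      case False
      then show ?thesis using \<open>z = f a\<close> \<open>a < n\<close> by auto
    qed
  qed
  then show ?thesis using prim unfolding f_def by blast
qed

lemma inj_on_cis_roots:
  assumes "n > 0"
  shows "inj_on (\<lambda>a. cis (2 * pi * real a / real n)) {1..n}"
proof (rule inj_onI)
  fix a b assume ab: "a \<in> {1..n}" "b \<in> {1..n}"
    "cis (2 * pi * real a / real n) = cis (2 * pi * real b / real n)"
  then have "a mod n = b mod n"
    using complex_root_unity_eq[of n a b] assms by (simp add: cis_conv_exp mult_ac)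
  then show "a = b" using ab
    by (cases "a = n"; cases "b = n") auto
qed

lemma cyclotomic_poly_eq_prod_prim_roots:
  assumes "n > 0"
  shows "cyclotomic_poly n = (\<Prod>z\<in>prim_roots n. [:- z, 1:])"
proof -
  have "inj_on (\<lambda>a. cis (2 * pi * real a / real n)) {a\<in>{1..n}. coprime a n}"
    by (rule inj_on_subset[OF inj_on_cis_roots[OF assms]]) auto
  then show ?thesis
    unfolding prim_roots_eq_image_cis[OF assms] cyclotomic_poly_def
    by (subst prod.reindex) (simp_all add: o_def)
qed

section \<open>Orders of negated roots of unity\<close>

lemma uminus_power_odd_even: "(- z) ^ m = (if even m then z ^ m else - (z ^ m))" for z :: complex
  by (simp add: minus_power_mult_self uminus_power_if)

lemma power_double_eq_1:
  assumes "(- z) ^ m = (1::complex)"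
  shows "z ^ (2 * m) = 1"
proof -
  have "z ^ (2 * m) = ((- z) ^ m) ^ 2"
    by (simp add: mult.commute[of m] flip: power_mult)
  then show ?thesis using assms by simp
qed

lemma square_eq_1_D: "(z::complex) ^ (2 * m) = 1 \<Longrightarrow> z ^ m = 1 \<or> z ^ m = -1"
  using power2_eq_1_iff[of "z ^ m"] by (metis power_mult mult.commute)

lemma power_half_prim_root:
  assumes "z \<in> prim_roots (2 * m)" "m > 0"
  shows "z ^ m = -1"
proof -
  have "z ^ (2 * m) = 1" by (rule prim_roots_power[OF assms(1)])
  moreover have "z ^ m \<noteq> 1" using prim_rootsD[OF assms(1), of m] assms(2) by (auto dest: dvd_imp_le)
  ultimately show ?thesis using square_eq_1_D by blast
qed

text \<open>Squaring removes the sign: \<open>(- z) ^ m = 1\<close> makes the odd \<open>n\<close>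
  divide \<open>2 * m\<close>, hence \<open>m\<close>. Then \<open>z ^ m = 1\<close>, so the
  remaining sign is 1 and \<open>m\<close> is even.\<close>

lemma uminus_prim_roots_odd:
  assumes "odd n" "z \<in> prim_roots n"
  shows "- z \<in> prim_roots (2 * n)"
  unfolding prim_roots_def
proof (safe)
  fix m assume m: "(- z) ^ m = 1"
  then have "z ^ (2 * m) = 1" by (rule power_double_eq_1)
  then have "n dvd m" using assms prim_rootsD[OF assms(2)] by (simp add: coprime_dvd_mult_right_iff)
  then have "z ^ m = 1" by (simp add: prim_rootsD[OF assms(2)])
  with m have "even m" by (auto simp: uminus_power_odd_even split: if_splits)
  with \<open>n dvd m\<close> \<open>odd n\<close> show "2 * n dvd m" by (intro divides_mult) auto
next
  fix m assume "2 * n dvd m"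
  then have "even m" "n dvd m" by (auto dest: dvd_mult_left dvd_mult_right)
  then show "(- z) ^ m = 1" by (simp add: prim_rootsD[OF assms(2)])
qed

text \<open>Since \<open>m\<close> is odd and \<open>z ^ m = -1\<close>, negation gives
  \<open>(- z) ^ m = 1\<close>. Conversely, squaring \<open>(- z) ^ l = 1\<close> shows that
  \<open>2 * m\<close> divides \<open>2 * l\<close>.\<close>

lemma uminus_prim_roots_even:
  assumes "odd m" "z \<in> prim_roots (2 * m)"
  shows "- z \<in> prim_roots m"
  unfolding prim_roots_def
proof (safe)
  have h: "z ^ m = -1" by (rule power_half_prim_root) (use assms odd_pos in auto)
  fix l
  {
    assume l: "(- z) ^ l = 1"
    then have "z ^ (2 * l) = 1" by (rule power_double_eq_1)
    then show "m dvd l" by (simp add: prim_rootsD[OF assms(2)])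
  next
    assume "m dvd l"
    then obtain q where "l = m * q" by blast
    moreover have "(- z) ^ m = 1" using assms(1) h by simp
    ultimately show "(- z) ^ l = 1" by (simp add: power_mult)
  }
qed

text \<open>If \<open>(- z) ^ l = 1\<close>, squaring gives \<open>n dvd 2 * l\<close>; as 4 divides
  \<open>n\<close>, the exponent \<open>l\<close> is even and the sign disappears.\<close>

lemma uminus_prim_roots_4:
  assumes "4 dvd n" "n > 0" "z \<in> prim_roots n"
  shows "- z \<in> prim_roots n"
  unfolding prim_roots_def
proof (safe)
  fix l
  {
    assume l: "(- z) ^ l = 1"
    then have "z ^ (2 * l) = 1" by (rule power_double_eq_1)
    then have "n dvd 2 * l" by (simp add: prim_rootsD[OF assms(3)])
    then have "4 dvd 2 * l" using assms by (blast intro: dvd_trans)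
    then have "even l" by presburger
    then show "n dvd l" using l by (simp add: prim_rootsD[OF assms(3)])
  next
    assume "n dvd l"
    moreover have "2 dvd (4::nat)" by simp
    ultimately have "even l" using assms(1) by (blast intro: dvd_trans)
    then show "(- z) ^ l = 1" using \<open>n dvd l\<close> by (simp add: prim_rootsD[OF assms(3)])
  }
qed

lemma n_alpha_cases:
  assumes "n > 0"
  obtains (odd) "odd n" "n_alpha n = 2 * n"
    | (two) m where "n = 2 * m" "odd m" "n_alpha n = m"
    | (four) "4 dvd n" "n_alpha n = n"
proof (cases "odd n")
  case True
  then have "real (n_alpha n) = real (2 * n)" by (simp only: of_nat_n_alpha) (simp add: alpha_def)
  then have "n_alpha n = 2 * n" by (simp only: of_nat_eq_iff)
  with True show ?thesis by (rule that(1))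
next
  case False
  then obtain m where m: "n = 2 * m" by blast
  show ?thesis
  proof (cases "4 dvd n")
    case True
    then have "real (n_alpha n) = real n" using False by (simp only: of_nat_n_alpha) (simp add: alpha_def)
    then have "n_alpha n = n" by (simp only: of_nat_eq_iff)
    with True show ?thesis by (rule that(3))
  next
    case f: False
    then have "real (n_alpha n) = real m" using False by (simp only: of_nat_n_alpha) (simp add: alpha_def m)
    then have "n_alpha n = m" by (simp only: of_nat_eq_iff)
    moreover have "odd m" using f m by presburger
    ultimately show ?thesis using m by (intro that(2))
  qed
qed

text \<open>The factor \<open>alpha n\<close> is what turns the order \<open>n\<close> of
  \<open>z\<close> into the order of \<open>- z\<close>. Negation is an involution, so it is enough
  that it maps each set into the other.\<close>

lemma uminus_image_prim_roots:
  assumes "n > 0"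
  shows "prim_roots n = uminus ` prim_roots (n_alpha n)"
proof -
  have sw: "A = uminus ` B" if "\<And>z. z \<in> A \<Longrightarrow> - z \<in> B" "\<And>z. z \<in> B \<Longrightarrow> - z \<in> A"
    for A B :: "complex set"
    using that by force
  show ?thesis using assms
  proof (cases rule: n_alpha_cases)
    case odd
    then show ?thesis by (intro sw) (auto intro: uminus_prim_roots_odd uminus_prim_roots_even)
  next
    case (two m)
    then show ?thesis by (intro sw) (auto intro: uminus_prim_roots_odd uminus_prim_roots_even)
  next
    case four
    then show ?thesis using assms by (intro sw) (auto intro: uminus_prim_roots_4)
  qed
qed

subsection \<open>Power series\<close>

text \<open>The derivative multiplied by \<open>h\<close> is again a derivation, so logarithmic
  derivatives add over a product. The equations are multiplied out to avoid dividing by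
  \<open>f i\<close>.\<close>

lemma fps_deriv_prod_of_log_deriv:
  fixes f g :: "'b \<Rightarrow> 'a::comm_ring_1 fps"
  assumes "\<And>i. i \<in> I \<Longrightarrow> h * fps_deriv (f i) = g i * f i"
  shows "h * fps_deriv (\<Prod>i\<in>I. f i) = (\<Sum>i\<in>I. g i) * (\<Prod>i\<in>I. f i)"
  using assms
proof (induction I rule: infinite_finite_induct)
  case (insert i I)
  have "h * fps_deriv (\<Prod>i\<in>insert i I. f i) =
      f i * (h * fps_deriv (\<Prod>i\<in>I. f i)) + (h * fps_deriv (f i)) * (\<Prod>i\<in>I. f i)"
    using insert.hyps by (simp add: algebra_simps)
  also have "h * fps_deriv (\<Prod>i\<in>I. f i) = (\<Sum>i\<in>I. g i) * (\<Prod>i\<in>I. f i)"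
    using insert.prems by (intro insert.IH) auto
  also have "h * fps_deriv (f i) = g i * f i" using insert.prems by simp
  finally show ?case using insert.hyps by (simp add: algebra_simps)
qed auto

text \<open>The series \<open>fps_ln 1\<close> is the compositional inverse of
  \<open>fps_exp 1 - 1\<close>; the general case follows by taking powers.\<close>

lemma fps_exp_compose_ln: "fps_exp (of_nat m) oo fps_ln 1 = (1 + fps_X :: complex fps) ^ m"
proof -
  have "(fps_exp 1 - 1 :: complex fps) oo fps_ln 1 = fps_X"
    by (subst fps_ln_fps_exp_inv) (auto intro!: fps_inv_right)
  then have "(fps_exp 1 :: complex fps) oo fps_ln 1 = 1 + fps_X"
    by (simp add: fps_compose_sub_distrib algebra_simps)
  then have "(1 + fps_X :: complex fps) ^ m = (fps_exp 1 oo fps_ln 1) ^ m" by simp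
  also have "\<dots> = fps_exp 1 ^ m oo fps_ln 1" by (rule fps_compose_power) simp
  finally show ?thesis by (simp add: fps_exp_power_mult)
qed

text \<open>By the chain rule, multiplying a derivative by \<open>1 + fps_X\<close> therefore
  differentiates with respect to \<open>t = fps_ln 1\<close>.\<close>

lemma one_plus_fps_X_mult_deriv_ln: "(1 + fps_X) * fps_deriv (fps_ln 1) = (1 :: complex fps)"
  by (simp add: fps_ln_deriv inverse_mult_eq_1')

lemma fps_ln_1_nonzero: "fps_ln 1 \<noteq> (0 :: complex fps)"
proof
  assume "fps_ln 1 = (0 :: complex fps)"
  then have "fps_ln 1 $ 1 = (0::complex)" by simp
  then show False by (simp add: fps_ln_nth)
qed

section \<open>Stirling numbers and powers of the logarithm\<close>

lemma signed_stirling_0: "signed_stirling 0 j = (if j = 0 then 1 else 0)"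
  by (simp add: signed_stirling_def)

lemma signed_stirling_Suc:
  "signed_stirling (Suc i) j = (if j = 0 then 0 else signed_stirling i (j - 1)) - int i * signed_stirling i j"
proof -
  have "(\<Prod>l<Suc i. [:- int l, 1:]) = [:- int i, 1:] * (\<Prod>l<i. [:- int l, 1:])"
    by (simp add: mult.commute)
  then show ?thesis by (cases j) (simp_all add: signed_stirling_def coeff_pCons)
qed

text \<open>Differentiating \<open>t ^ j\<close> with respect to \<open>t = fps_ln 1\<close> gives
  \<open>j * t ^ (j - 1)\<close>. Comparing coefficients yields the recurrence of the Stirling
  numbers.\<close>

lemma fps_ln_power_nth:
  "(fps_ln 1 ^ j) $ i = (fact j * of_int (signed_stirling i j) / fact i :: complex)"
proof (induction i arbitrary: j)
  case 0
  show ?case by (cases j) (simp_all add: signed_stirling_0)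
next
  case (Suc i)
  let ?L = "fps_ln 1 :: complex fps"
  \<comment> \<open>For \<open>j = 0\<close> the truncated exponent \<open>j - 1\<close> is
    harmless, because the factor \<open>of_nat j\<close> vanishes.\<close>
  have "(1 + fps_X) * fps_deriv (?L ^ j) = of_nat j * ?L ^ (j - 1) * ((1 + fps_X) * fps_deriv ?L)"
    by (simp add: fps_deriv_power fps_of_nat mult_ac)
  then have "(1 + fps_X) * fps_deriv (?L ^ j) = of_nat j * ?L ^ (j - 1)"
    by (simp only: one_plus_fps_X_mult_deriv_ln mult_1_right)
  then have "((1 + fps_X) * fps_deriv (?L ^ j)) $ i = (fps_const (of_nat j) * ?L ^ (j - 1)) $ i"
    by (simp add: fps_of_nat)
  then have "of_nat (Suc i) * (?L ^ j) $ Suc i + of_nat i * (?L ^ j) $ i = of_nat j * (?L ^ (j - 1)) $ i"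
    by (cases i) (simp_all add: ring_distribs)
  then have eq: "of_nat (Suc i) * (?L ^ j) $ Suc i =
      of_nat j * (fact (j - 1) * of_int (signed_stirling i (j - 1)) / fact i) -
      of_nat i * (fact j * of_int (signed_stirling i j) / fact i)"
    by (simp only: Suc.IH) (simp add: algebra_simps)
  also have "\<dots> = fact j * of_int (signed_stirling (Suc i) j) / fact i"
    by (cases j) (simp_all add: signed_stirling_Suc field_simps)
  also have "\<dots> = of_nat (Suc i) * (fact j * of_int (signed_stirling (Suc i) j) / fact (Suc i))"
    by (simp add: field_simps del: of_nat_Suc)
  finally show ?case by (metis mult_left_cancel of_nat_eq_0_iff nat.distinct(1))
qed

section \<open>Bernoulli numbers and the quotient of exponentials\<close>

definition bernoulli_fps :: "complex fps" where
  "bernoulli_fps = Abs_fps (\<lambda>j. of_real (bernoulli_plus_fps $ j))"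

lemma bernoulli_fps_mult: "bernoulli_fps * (fps_exp 1 - 1) = fps_X * fps_exp 1"
proof (rule fps_ext)
  fix n
  have "(bernoulli_fps * (fps_exp 1 - 1)) $ n = of_real ((bernoulli_plus_fps * (fps_exp 1 - 1)) $ n)"
    by (auto simp: fps_mult_nth bernoulli_fps_def intro!: sum.cong)
  also have "\<dots> = (fps_X * fps_exp 1 :: complex fps) $ n"
    unfolding bernoulli_plus_fps_mult by simp
  finally show "(bernoulli_fps * (fps_exp 1 - 1)) $ n = (fps_X * fps_exp 1) $ n" .
qed

text \<open>With \<open>t = fps_ln 1\<close>, \<open>b c\<close> is the Bernoulli generating
  function at \<open>c * t\<close>, and \<open>exp (c * t)\<close> is
  \<open>(1 + fps_X) ^ c\<close>.\<close>

lemma bernoulli_fps_compose: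
  defines "b \<equiv> \<lambda>c::nat. (bernoulli_fps oo (fps_const (of_nat c) * fps_X)) oo fps_ln 1"
  shows "b c * ((1 + fps_X) ^ c - 1) = of_nat c * fps_ln 1 * (1 + fps_X) ^ c"
proof -
  let ?cX = "fps_const (of_nat c) * fps_X :: complex fps"
  have "(bernoulli_fps oo ?cX) * (fps_exp (of_nat c) - 1) = (bernoulli_fps * (fps_exp 1 - 1)) oo ?cX"
    by (simp add: fps_compose_mult_distrib fps_compose_sub_distrib)
  also have "\<dots> = ?cX * fps_exp (of_nat c)"
    by (simp add: bernoulli_fps_mult fps_compose_mult_distrib)
  finally have "((bernoulli_fps oo ?cX) * (fps_exp (of_nat c) - 1)) oo fps_ln 1 =
      (?cX * fps_exp (of_nat c)) oo fps_ln 1" by simp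
  then show ?thesis
    unfolding b_def
    by (simp add: fps_compose_mult_distrib fps_compose_sub_distrib fps_exp_compose_ln fps_of_nat)
qed

text \<open>A series in \<open>t\<close>, linear in \<open>c\<close>. The coefficient at index
  \<open>i\<close> belongs to \<open>j = Suc i\<close>, because it comes from differentiating a term
  in \<open>t ^ j\<close>.\<close>

definition log_deriv_fps :: "(nat \<Rightarrow> real) \<Rightarrow> complex fps" where
  "log_deriv_fps c = Abs_fps (\<lambda>i. of_real (bernoulli_plus (Suc i) * c (Suc i) / fact (Suc i)))"

lemma log_deriv_fps_sum:
  "log_deriv_fps (\<lambda>j. \<Sum>d\<in>D. c d j) = (\<Sum>d\<in>D. log_deriv_fps (c d))"
  by (rule fps_ext) (simp add: log_deriv_fps_def fps_sum_nth sum_distrib_left sum_divide_distrib)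

text \<open>With \<open>t = fps_ln 1\<close>, \<open>U\<close> is
  \<open>(exp (m * t) - 1) / (exp t - 1)\<close>. Multiplied by \<open>t\<close>, the logarithmic
  derivatives in \<open>t\<close> of numerator and denominator are the Bernoulli series at
  \<open>m * t\<close> and at \<open>t\<close>. The computation carries the factors \<open>t\<close>
  and \<open>fps_X\<close> along and cancels them at the end.\<close>

lemma log_deriv_of_quotient:
  assumes U: "U * fps_X = (1 + fps_X) ^ m - 1"
  shows "(1 + fps_X) * fps_deriv U = (log_deriv_fps (\<lambda>j. real m ^ j - 1) oo fps_ln 1) * U"
proof -
  let ?L = "fps_ln 1 :: complex fps" and ?Y = "1 + fps_X :: complex fps"
  define R where "R = log_deriv_fps (\<lambda>j. real m ^ j - 1) oo ?L"
  define b where "b = (\<lambda>c::nat. (bernoulli_fps oo (fps_const (of_nat c) * fps_X)) oo ?L)"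
  have b: "b c * (?Y ^ c - 1) = of_nat c * ?L * ?Y ^ c" for c
    unfolding b_def by (rule bernoulli_fps_compose)
  have b1: "b 1 * fps_X = ?L * ?Y" using b[of 1] by simp
  \<comment> \<open>Both series on the right have the same constant coefficient, so their difference
    is divisible by \<open>fps_X\<close>.\<close>
  have "fps_X * log_deriv_fps (\<lambda>j. real m ^ j - 1) =
      (bernoulli_fps oo (fps_const (of_nat m) * fps_X)) - (bernoulli_fps oo (fps_const (of_nat 1) * fps_X))"
  proof (rule fps_ext)
    fix j
    have nth: "(bernoulli_fps oo (fps_const (of_nat c) * fps_X)) $ j = of_nat c ^ j * of_real (bernoulli_plus j) / fact j"
      for c by (simp add: fps_compose_linear bernoulli_fps_def bernoulli_plus_def)
    show "(fps_X * log_deriv_fps (\<lambda>j. real m ^ j - 1)) $ j =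
        ((bernoulli_fps oo (fps_const (of_nat m) * fps_X)) - (bernoulli_fps oo (fps_const (of_nat 1) * fps_X))) $ j"
      unfolding fps_sub_nth nth
      by (cases j) (simp_all add: log_deriv_fps_def algebra_simps diff_divide_distrib del: fact_Suc)
  qed
  from arg_cong[OF this, of "\<lambda>f. f oo ?L"] have R: "?L * R = b m - b 1"
    by (simp add: fps_compose_mult_distrib fps_compose_sub_distrib R_def b_def)
  have "fps_deriv (U * fps_X) = of_nat m * ?Y ^ (m - 1)"
    unfolding U by (simp add: fps_deriv_power fps_of_nat)
  then have dU: "fps_deriv U * fps_X = of_nat m * ?Y ^ (m - 1) - U"
    by (simp add: algebra_simps)
  have Ym: "of_nat m * ?Y * ?Y ^ (m - 1) = of_nat m * ?Y ^ m" by (cases m) simp_all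
  have "?L * fps_X * (?Y * fps_deriv U) = ?L * ?Y * (fps_deriv U * fps_X)" by (simp only: mult_ac)
  also have "\<dots> = ?L * (of_nat m * ?Y * ?Y ^ (m - 1)) - ?L * ?Y * U"
    unfolding dU by (simp only: right_diff_distrib mult_ac)
  also have "\<dots> = b m * (?Y ^ m - 1) - b 1 * fps_X * U"
    unfolding Ym b b1 by (simp only: mult_ac)
  also have "\<dots> = (b m - b 1) * fps_X * U"
    unfolding U[symmetric] by (simp add: algebra_simps)
  also have "\<dots> = ?L * fps_X * (R * U)" unfolding R[symmetric] by (simp only: mult_ac)
  finally have "?Y * fps_deriv U = R * U"
    using fps_ln_1_nonzero by (simp only: mult_cancel_left) simp
  then show ?thesis by (simp only: R_def)
qed

subsection \<open>Logarithmic derivatives of cyclotomic polynomials\<close>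

text \<open>For \<open>d > 0\<close> this is the Taylor expansion at 1 of the cyclotomic polynomial
  of index \<open>d\<close>.\<close>

definition cyc_fps :: "nat \<Rightarrow> complex fps" where
  "cyc_fps d = (\<Prod>z\<in>prim_roots d. 1 + fps_X - fps_const z)"

lemma cyc_fps_nonzero: "cyc_fps d \<noteq> 0"
proof -
  have "1 + fps_X - fps_const z \<noteq> 0" for z :: complex
  proof
    assume "1 + fps_X - fps_const z = 0"
    then have "(1 + fps_X - fps_const z) $ 1 = 0" by simp
    then show False by simp
  qed
  then show ?thesis
    by (cases "finite (prim_roots d)") (auto simp: cyc_fps_def)
qed

lemma fps_of_poly_linear_shift:
  "fps_of_poly (pcompose [:- z, 1:] [:c, 1:]) = fps_const c + fps_X - fps_const z"
  for c :: "'a::comm_ring_1"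
  by (rule fps_ext) (auto simp: pcompose_pCons coeff_pCons split: nat.split)

text \<open>The polynomial is monic, and its derivative has no root in common with it: such a root
  would have to be 0, which is no root of unity.\<close>

lemma prod_roots_unity_poly:
  assumes "n > 0"
  shows "(\<Prod>z | z ^ n = 1. [:- z, 1:]) = monom (1::complex) n - 1"
proof -
  let ?p = "monom (1::complex) n - 1"
  have deg: "degree ?p = n"
    unfolding diff_conv_add_uminus using assms by (subst degree_add_eq_left) (auto simp: degree_monom_eq)
  have lc: "lead_coeff ?p = 1" using assms by (simp add: deg)
  have poly: "poly ?p z = z ^ n - 1" for z by (simp add: poly_monom)
  have "rsquarefree ?p"
    unfolding rsquarefree_roots using assms
    by (auto simp: poly pderiv_diff pderiv_monom poly_monom power_0_left)
  from complex_poly_decompose_rsquarefree[OF this] show ?thesis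
    unfolding lc poly by simp
qed

text \<open>Sorting the roots of unity by order factors the \<open>n\<close>-th power minus 1 over
  the divisors of \<open>n\<close>; the variable is then shifted to
  \<open>1 + fps_X\<close>.\<close>

lemma prod_cyc_fps_divisors:
  assumes "n > 0"
  shows "(\<Prod>d | d dvd n. cyc_fps d) = (1 + fps_X) ^ n - 1"
proof -
  have fin: "finite {d. d dvd n}" using assms by simp
  have "(\<Prod>d | d dvd n. cyc_fps d) = (\<Prod>z\<in>(\<Union>d\<in>{d. d dvd n}. prim_roots d). 1 + fps_X - fps_const z)"
    unfolding cyc_fps_def using assms
    by (intro prod.UNION_disjoint[symmetric] ballI impI prim_roots_disjoint finite_prim_roots fin)
      (auto intro!: gr0I)
  also have "\<dots> = (\<Prod>z | z ^ n = 1. 1 + fps_X - fps_const z)"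
    by (simp only: roots_unity_eq_Union_prim_roots[OF assms])
  also have "\<dots> = fps_of_poly (pcompose (\<Prod>z | z ^ n = 1. [:- z, 1:]) [:1, 1:])"
    by (simp only: pcompose_prod fps_of_poly_prod fps_of_poly_linear_shift fps_const_1_eq_1)
  also have "\<dots> = (1 + fps_X) ^ n - 1"
  proof -
    have "pcompose (monom 1 n - 1) [:1, 1:] = [:1, 1:] ^ n - (1 :: complex poly)"
      by (subst poly_eq_poly_eq_iff[symmetric]) (simp add: fun_eq_iff poly_pcompose poly_monom)
    then show ?thesis
      by (simp add: prod_roots_unity_poly[OF assms] fps_of_poly_diff fps_of_poly_power fps_of_poly_pCons)
  qed
  finally show ?thesis .
qed

lemma prim_roots_1: "prim_roots 1 = {1}"
  unfolding prim_roots_def by (auto dest: spec[of _ 1])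

lemma log_deriv_cyc_fps:
  assumes "n > 1"
  shows "(1 + fps_X) * fps_deriv (cyc_fps n) =
    (log_deriv_fps (\<lambda>j. jordan_totient j n) oo fps_ln 1) * cyc_fps n"
  using assms
proof (induction n rule: less_induct)
  case (less n)
  let ?J = "\<lambda>d j. jordan_totient j d" and ?Y = "1 + fps_X :: complex fps"
  define D where "D = {d. d dvd n} - {1, n}"
  define R where "R = (\<lambda>d. log_deriv_fps (?J d) oo fps_ln 1)"
  define V where "V = (\<Prod>d\<in>D. cyc_fps d)"
  have fin: "finite D" and nD: "n \<notin> D" "1 \<notin> insert n D"
    and div: "{d. d dvd n} = insert 1 (insert n D)"
    using less.prems by (auto simp: D_def)
  \<comment> \<open>The divisor 1 contributes \<open>cyc_fps 1 = fps_X\<close>. It is kept out of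
    \<open>V\<close> because its logarithmic derivative is not a power series; its Jordan totient is
    the 1 subtracted from \<open>real n ^ j\<close> below.\<close>
  have "cyc_fps n * V * fps_X = (\<Prod>d | d dvd n. cyc_fps d)"
    unfolding div V_def using fin nD prim_roots_1 by (simp add: cyc_fps_def mult_ac)
  also have "\<dots> = ?Y ^ n - 1" using less.prems by (intro prod_cyc_fps_divisors) simp
  finally have "?Y * fps_deriv (cyc_fps n * V) =
      (log_deriv_fps (\<lambda>j. real n ^ j - 1) oo fps_ln 1) * (cyc_fps n * V)"
    by (rule log_deriv_of_quotient)
  also have "(\<lambda>j. real n ^ j - 1) = (\<lambda>j. \<Sum>d\<in>insert n D. ?J d j)"
  proof
    fix j
    have "real n ^ j = (\<Sum>d | d dvd n. ?J d j)"
      using less.prems by (intro sum_jordan_totient_divisors[symmetric]) simp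
    also have "\<dots> = 1 + (\<Sum>d\<in>insert n D. ?J d j)"
      unfolding div using fin nD jordan_totient_1 by (subst sum.insert) auto
    finally show "real n ^ j - 1 = (\<Sum>d\<in>insert n D. ?J d j)" by simp
  qed
  also have "log_deriv_fps (\<lambda>j. \<Sum>d\<in>insert n D. ?J d j) oo fps_ln 1 = R n + (\<Sum>d\<in>D. R d)"
    unfolding log_deriv_fps_sum fps_compose_sum_distrib using fin nD by (simp add: R_def)
  finally have 1: "?Y * fps_deriv (cyc_fps n * V) = (R n + (\<Sum>d\<in>D. R d)) * (cyc_fps n * V)" .
  have 2: "?Y * fps_deriv V = (\<Sum>d\<in>D. R d) * V"
    unfolding V_def R_def
  proof (rule fps_deriv_prod_of_log_deriv, rule less.IH)
    fix d assume "d \<in> D"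
    then have "d dvd n" "d \<noteq> 1" "d \<noteq> n" by (auto simp: D_def)
    moreover from this have "d \<noteq> 0" "d \<le> n" using less.prems by (auto dest: dvd_imp_le intro!: gr0I)
    ultimately show "d < n" "1 < d" by auto
  qed
  \<comment> \<open>By the product rule, the known contribution of \<open>V\<close> is subtracted;
    the nonzero factor \<open>V\<close> then cancels.\<close>
  have "V * (?Y * fps_deriv (cyc_fps n)) = ?Y * fps_deriv (cyc_fps n * V) - cyc_fps n * (?Y * fps_deriv V)"
    by (simp add: algebra_simps)
  also have "\<dots> = V * (R n * cyc_fps n)"
    unfolding 1 2 by (simp add: algebra_simps)
  finally have "?Y * fps_deriv (cyc_fps n) = R n * cyc_fps n"
    using fin cyc_fps_nonzero by (simp only: mult_cancel_left) (auto simp: V_def)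
  then show ?case by (simp only: R_def)
qed

text \<open>Passing from \<open>t\<close> back to \<open>u\<close>: an antiderivative in
  \<open>t\<close> of the logarithmic derivative, composed with \<open>fps_ln 1\<close>, has the
  logarithmic derivative in \<open>u\<close> as its derivative. Expanding the powers of
  \<open>fps_ln 1\<close> produces the numbers \<open>x i\<close>.\<close>

lemma cyc_fps_ode:
  assumes "n > 1"
  defines "x \<equiv> \<lambda>i. \<Sum>j=1..i. bernoulli_plus j * of_int (signed_stirling i j) / real j * jordan_totient j n"
  obtains F where "fps_deriv (cyc_fps n) = F * cyc_fps n"
    "\<And>i. F $ i = of_real (x (Suc i)) / fact i"
proof
  let ?L = "fps_ln 1 :: complex fps" and ?R = "log_deriv_fps (\<lambda>j. jordan_totient j n)"
  \<comment> \<open>an antiderivative of \<open>?R\<close>; its constant term is \<open>0\<close> because \<open>x / 0 = 0\<close>\<close>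
  define G :: "complex fps" where
    "G = Abs_fps (\<lambda>j. of_real (bernoulli_plus j * jordan_totient j n / (real j * fact j)))"
  have "fps_deriv G = ?R"
    by (rule fps_ext) (simp add: G_def log_deriv_fps_def del: of_nat_Suc)
  then have dG: "fps_deriv (G oo ?L) = (?R oo ?L) * fps_deriv ?L"
    by (simp add: fps_compose_deriv)
  have "fps_deriv (G oo ?L) * cyc_fps n = fps_deriv ?L * ((1 + fps_X) * fps_deriv (cyc_fps n))"
    unfolding dG log_deriv_cyc_fps[OF assms(1)] by (simp only: mult_ac)
  also have "\<dots> = ((1 + fps_X) * fps_deriv ?L) * fps_deriv (cyc_fps n)" by (simp only: mult_ac)
  also have "\<dots> = fps_deriv (cyc_fps n)" unfolding one_plus_fps_X_mult_deriv_ln by simp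
  finally show "fps_deriv (cyc_fps n) = fps_deriv (G oo ?L) * cyc_fps n" by simp
  fix i
  have "(G oo ?L) $ m = of_real (x m) / fact m" for m
  proof -
    have "(G oo ?L) $ m = (\<Sum>j=0..m. G $ j * (?L ^ j) $ m)" by (rule fps_compose_nth)
    also have "\<dots> = (\<Sum>j=1..m. G $ j * (?L ^ j) $ m)"
      by (rule sum.mono_neutral_right) (auto simp: G_def)
    also have "\<dots> = (\<Sum>j=1..m. of_real (bernoulli_plus j * of_int (signed_stirling m j) / real j *
        jordan_totient j n) / fact m)"
      by (rule sum.cong) (simp_all add: G_def fps_ln_power_nth)
    finally show ?thesis by (simp add: x_def sum_divide_distrib)
  qed
  then show "fps_deriv (G oo ?L) $ i = of_real (x (Suc i)) / fact i"
    by (simp del: of_nat_Suc)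
qed

section \<open>Taylor expansion at -1 and conclusion\<close>

lemma poly_higher_pderiv_shift:
  "poly ((pderiv ^^ k) p) c = fact k * coeff (pcompose p [:c, 1:]) k"
  for p :: "'a::field_char_0 poly"
proof -
  have "(pderiv ^^ k) (pcompose p [:c, 1:]) = pcompose ((pderiv ^^ k) p) [:c, 1:]"
    by (induction k) (simp_all add: pderiv_pcompose pderiv_pCons)
  then have "poly ((pderiv ^^ k) p) c = coeff ((pderiv ^^ k) (pcompose p [:c, 1:])) 0"
    by (simp add: poly_pcompose flip: poly_0_coeff_0)
  then show ?thesis by (simp add: coeff_higher_pderiv pochhammer_fact)
qed

text \<open>The number -1 has order 2, so it is a root only for \<open>n = 2\<close>.\<close>

lemma cyclotomic_poly_minus_1_nonzero:
  assumes "n > 0" "n \<noteq> 2"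
  shows "poly (cyclotomic_poly n) (-1) \<noteq> 0"
proof -
  have "- 1 \<notin> prim_roots n"
  proof
    assume m: "- 1 \<in> prim_roots n"
    have "n dvd 2" using prim_rootsD[OF m, of 2] by simp
    moreover have "\<not> n dvd 1" using prim_rootsD[OF m, of 1] by simp
    ultimately show False using assms by (auto dest!: dvd_imp_le) 
  qed
  then show ?thesis
    using assms finite_prim_roots[of n]
    by (auto simp: cyclotomic_poly_eq_prod_prim_roots poly_prod add_eq_0_iff minus_equation_iff[of _ 1])
qed

text \<open>For a root \<open>z = - w\<close>, the shifted factor \<open>-1 + u - z\<close> equals
  \<open>- (1 + (- u) - w)\<close>. The signs collect in the constant \<open>s\<close>, whose value
  does not affect the logarithmic derivative.\<close>

lemma cyclotomic_poly_shift:
  assumes "n > 0"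
  obtains s where "fps_of_poly (pcompose (cyclotomic_poly n) [:-1, 1:]) =
    fps_const s * (cyc_fps (n_alpha n) oo - fps_X)"
proof
  let ?Z = "prim_roots (n_alpha n)"
  have "fps_of_poly (pcompose (cyclotomic_poly n) [:-1, 1:]) =
      (\<Prod>z\<in>prim_roots n. fps_const (- 1) + fps_X - fps_const z)"
    unfolding cyclotomic_poly_eq_prod_prim_roots[OF assms]
    by (simp only: pcompose_prod fps_of_poly_prod fps_of_poly_linear_shift fps_const_1_eq_1)
  also have "\<dots> = (\<Prod>w\<in>?Z. fps_const (-1) * ((1 + fps_X - fps_const w) oo - fps_X))"
    unfolding uminus_image_prim_roots[OF assms]
    by (subst prod.reindex)
      (auto simp: fps_compose_sub_distrib fps_compose_add_distrib intro!: prod.cong)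
  also have "\<dots> = fps_const ((-1) ^ card ?Z) * (cyc_fps (n_alpha n) oo - fps_X)"
    by (simp add: prod.distrib cyc_fps_def fps_compose_prod_distrib flip: fps_const_power)
  finally show "fps_of_poly (pcompose (cyclotomic_poly n) [:-1, 1:]) =
      fps_const ((-1) ^ card ?Z) * (cyc_fps (n_alpha n) oo - fps_X)" .
qed

theorem theorem3p9:
  fixes k n :: nat and y :: "nat \<Rightarrow> real"
  assumes "k > 0" and "n > 0" and "n \<noteq> 2"
    and "\<And>i. 1 \<le> i \<Longrightarrow> i \<le> k \<Longrightarrow>
           y i = (-1) ^ i * (\<Sum>j=1..i. bernoulli_plus j * of_int (signed_stirling i j) / real j
                                       * jordan_totient j (n_alpha n))"
  shows "poly ((pderiv ^^ k) (cyclotomic_poly n)) (-1) / poly (cyclotomic_poly n) (-1)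
         = complex_of_real (complete_bell k y)"
proof -
  define g where "g = fps_of_poly (pcompose (cyclotomic_poly n) [:-1, 1:])"
  have g: "poly ((pderiv ^^ i) (cyclotomic_poly n)) (-1) = fact i * g $ i" for i
    by (simp add: g_def poly_higher_pderiv_shift)
  have N: "n_alpha n > 1"
    using \<open>n > 0\<close> \<open>n \<noteq> 2\<close> by (cases rule: n_alpha_cases[OF \<open>n > 0\<close>]) (auto dest: dvd_imp_le)
  obtain F where F: "fps_deriv (cyc_fps (n_alpha n)) = F * cyc_fps (n_alpha n)"
    "\<And>i. F $ i = of_real (\<Sum>j=1..Suc i. bernoulli_plus j * of_int (signed_stirling (Suc i) j) / real j
                                       * jordan_totient j (n_alpha n)) / fact i"
    using cyc_fps_ode[OF N] by blast
  obtain s where s: "g = fps_const s * (cyc_fps (n_alpha n) oo - fps_X)"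
    using cyclotomic_poly_shift[OF \<open>n > 0\<close>] unfolding g_def by blast
  \<comment> \<open>The minus sign is the inner derivative of \<open>- fps_X\<close>. With the sign
    \<open>(-1) ^ i\<close> from the substitution, coefficient \<open>i\<close> gets the factor
    \<open>(-1) ^ Suc i\<close> that occurs in \<open>y (Suc i)\<close>.\<close>
  have "fps_deriv g = - (F oo - fps_X) * g"
    unfolding s by (simp add: fps_compose_deriv F(1) fps_compose_mult_distrib mult_ac)
  moreover have "(- (F oo - fps_X)) $ i = of_real (y (Suc i)) / fact i" if "i < k" for i
    using assms(4)[of "Suc i"] that by (simp add: fps_compose_uminus' F(2))
  ultimately have "fact k * g $ k = g $ 0 * of_real (complete_bell k y)"
    by (rule fps_nth_eq_complete_bell)
  moreover have "poly (cyclotomic_poly n) (-1) = g $ 0" using g[of 0] by simp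
  ultimately show ?thesis
    using cyclotomic_poly_minus_1_nonzero[OF assms(2,3)] by (simp add: g)
qed

end
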